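(* Let $\pi_t^{\mathrm{out}}\in\mathbb{R}^m$ be an optimal dual solution of the current restricted master problem, with $\mathcal Q_-(\pi_t^{\mathrm{out}})\neq\varnothing$. Assume the columns are uniformly bounded, i.e. $\bar a := \sup_{q\in Q}\|A_q\|_2<\infty$. If the stabilized dual $\pi_t^{\mathrm{sep}}\in\mathbb{R}^m$ satisfies $$\big\|\pi_t^{\mathrm{sep}}-\pi_t^{\mathrm{out}}\big\|_2\ \le\ \frac{\min\{\gamma_t^-,\gamma_t^+\}}{2\,\bar a},$$ then $r_{q(\pi_t^{\mathrm{sep}})}(\pi_t^{\mathrm{out}})<0$ (for every column $q(\pi_t^{\mathrm{sep}})$ that the exact pricing oracle may return at $\pi_t^{\mathrm{sep}}$), and mispricing does not occur.
   Context: Column generation setting. The master problem is the linear program $\min\{c^\top x : Ax=b,\ x\ge 0\}$ with $b\in\mathbb{R}^m$; $Q$ is the index set of all its columns, and column $q\in Q$ has coefficient vector $A_q\in\mathbb{R}^m$ and cost $c_q\in\mathbb{R}$. At iteration $t$ the restricted master problem (RMP) uses only the columns in a subset $R\subseteq Q$; its dual is $\max\{b^\top\pi : A_R^\top\pi\le c_R\}$, and $\pi_t^{\mathrm{out}}$ denotes an optimal solution of that dual. The reduced cost of column $q$ at $\pi\in\mathbb{R}^m$ is $r_q(\pi)=c_q-A_q^\top\pi$. The pricing problem at $\pi$ is $\sigma(\pi)=\min_{q\in Q}r_q(\pi)$; the pricing oracle is exact and returns a minimizer $q(\pi)\in\arg\min_{q\in Q}r_q(\pi)$. It is assumed that for every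 dual vector $\pi$ the pricing problem admits an optimal solution. In stabilized column generation, pricing is done at a stabilized dual $\pi_t^{\mathrm{sep}}$ instead of $\pi_t^{\mathrm{out}}$. Define $\mathcal Q_-(\pi_t^{\mathrm{out}})=\{q\in Q: r_q(\pi_t^{\mathrm{out}})<0\}$, $\mathcal Q_+(\pi_t^{\mathrm{out}})=\{q\in Q: r_q(\pi_t^{\mathrm{out}})\ge 0\}$, $\gamma_t^-=-\min_{q\in\mathcal Q_-(\pi_t^{\mathrm{out}})}r_q(\pi_t^{\mathrm{out}})$, and $\gamma_t^+=\min_{q\in\mathcal Q_+(\pi_t^{\mathrm{out}})}r_q(\pi_t^{\mathrm{out}})$, with $\gamma_t^+=+\infty$ if $\mathcal Q_+(\pi_t^{\mathrm{out}})=\varnothing$. Only iterations with $\mathcal Q_-(\pi_t^{\mathrm{out}})\ne\varnothing$ are considered. Mispricing: at iteration $t$, assuming $\sigma(\pi_t^{\mathrm{out}})<0$, a mispricing event occurs if the pricing oracle returns a column $q\in Q$ with $r_q(\pi_t^{\mathrm{out}})\ge 0$. *)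

theory Defs
  imports "HOL-Analysis.Analysis"
begin

text \<open>
  Columns are indexed by a set \<open>Q\<close> of an arbitrary type, finite or infinite; \<open>c q\<close> is the
  cost and \<open>A q\<close> the coefficient vector of column \<open>q\<close>.
\<close>

definition reduced_cost ::
    "('q \<Rightarrow> real) \<Rightarrow> ('q \<Rightarrow> real ^ 'm) \<Rightarrow> real ^ 'm \<Rightarrow> 'q \<Rightarrow> real" where
  "reduced_cost c A \<pi> q = c q - A q \<bullet> \<pi>"

definition rmp_dual_feasible ::
    "('q \<Rightarrow> real) \<Rightarrow> ('q \<Rightarrow> real ^ 'm) \<Rightarrow> 'q set \<Rightarrow> real ^ 'm \<Rightarrow> bool" where
  "rmp_dual_feasible c A R \<pi> \<longleftrightarrow> (\<forall>q\<in>R. A q \<bullet> \<pi> \<le> c q)"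

definition rmp_dual_optimal ::
    "real ^ 'm \<Rightarrow> ('q \<Rightarrow> real) \<Rightarrow> ('q \<Rightarrow> real ^ 'm) \<Rightarrow> 'q set \<Rightarrow> real ^ 'm \<Rightarrow> bool" where
  "rmp_dual_optimal b c A R \<pi> \<longleftrightarrow> is_arg_max (\<lambda>\<pi>'. b \<bullet> \<pi>') (rmp_dual_feasible c A R) \<pi>"

definition pricing_solutions ::
    "('q \<Rightarrow> real) \<Rightarrow> ('q \<Rightarrow> real ^ 'm) \<Rightarrow> 'q set \<Rightarrow> real ^ 'm \<Rightarrow> 'q set" where
  "pricing_solutions c A Q \<pi> = {q. is_arg_min (reduced_cost c A \<pi>) (\<lambda>q. q \<in> Q) q}"

definition exact_pricing_oracle ::
    "('q \<Rightarrow> real) \<Rightarrow> ('q \<Rightarrow> real ^ 'm) \<Rightarrow> 'q set \<Rightarrow> (real ^ 'm \<Rightarrow> 'q) \<Rightarrow> bool" where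
  "exact_pricing_oracle c A Q orc \<longleftrightarrow> (\<forall>\<pi>. orc \<pi> \<in> pricing_solutions c A Q \<pi>)"

text \<open>
  Minima over sets of columns are infima in \<open>ereal\<close>. They agree with the minima whenever these
  are attained, and the infimum over the empty set is \<open>\<infinity>\<close>, which is the convention wanted
  for \<open>gamma_plus\<close>.
\<close>

definition pricing_value ::
    "('q \<Rightarrow> real) \<Rightarrow> ('q \<Rightarrow> real ^ 'm) \<Rightarrow> 'q set \<Rightarrow> real ^ 'm \<Rightarrow> ereal" where
  "pricing_value c A Q \<pi> = (INF q\<in>Q. ereal (reduced_cost c A \<pi> q))"

definition Q_minus ::
    "('q \<Rightarrow> real) \<Rightarrow> ('q \<Rightarrow> real ^ 'm) \<Rightarrow> 'q set \<Rightarrow> real ^ 'm \<Rightarrow> 'q set" where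
  "Q_minus c A Q \<pi> = {q \<in> Q. reduced_cost c A \<pi> q < 0}"

definition Q_plus ::
    "('q \<Rightarrow> real) \<Rightarrow> ('q \<Rightarrow> real ^ 'm) \<Rightarrow> 'q set \<Rightarrow> real ^ 'm \<Rightarrow> 'q set" where
  "Q_plus c A Q \<pi> = {q \<in> Q. reduced_cost c A \<pi> q \<ge> 0}"

definition gamma_minus ::
    "('q \<Rightarrow> real) \<Rightarrow> ('q \<Rightarrow> real ^ 'm) \<Rightarrow> 'q set \<Rightarrow> real ^ 'm \<Rightarrow> ereal" where
  "gamma_minus c A Q \<pi> = - (INF q\<in>Q_minus c A Q \<pi>. ereal (reduced_cost c A \<pi> q))"

definition gamma_plus ::
    "('q \<Rightarrow> real) \<Rightarrow> ('q \<Rightarrow> real ^ 'm) \<Rightarrow> 'q set \<Rightarrow> real ^ 'm \<Rightarrow> ereal" where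
  "gamma_plus c A Q \<pi> = (INF q\<in>Q_plus c A Q \<pi>. ereal (reduced_cost c A \<pi> q))"

text \<open>
  With all columns zero, \<open>x / 0 = \<infinity>\<close> for \<open>x > 0\<close> in \<open>ereal\<close>, so a distance bound
  of the form \<open>x / (2 * column_bound A Q)\<close> is then no restriction, whereas real division would
  make it \<open>0\<close>.
\<close>

definition column_bound :: "('q \<Rightarrow> real ^ 'm) \<Rightarrow> 'q set \<Rightarrow> ereal" where
  "column_bound A Q = (SUP q\<in>Q. ereal (norm (A q)))"

definition mispricing ::
    "('q \<Rightarrow> real) \<Rightarrow> ('q \<Rightarrow> real ^ 'm) \<Rightarrow> 'q set \<Rightarrow> (real ^ 'm \<Rightarrow> 'q) \<Rightarrow>
      real ^ 'm \<Rightarrow> real ^ 'm \<Rightarrow> bool" where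
  "mispricing c A Q orc \<pi>_out \<pi>_sep \<longleftrightarrow>
     pricing_value c A Q \<pi>_out < 0 \<and> orc \<pi>_sep \<in> Q \<and> reduced_cost c A \<pi>_out (orc \<pi>_sep) \<ge> 0"

end

theory Submission imports Defs begin

text \<open>
  Moving the dual by \<open>d\<close> changes every reduced cost by at most \<open>a * d\<close>, where \<open>a\<close> bounds the
  column norms, so a minimizer \<open>q\<close> at the new dual exceeds any other column \<open>p\<close> at the old dual by
  at most \<open>2 * a * d\<close>.  If \<open>q\<close> were nonnegative at the old dual, this would be at most \<open>\<gamma>\<^sup>+\<close>,
  hence at most the reduced cost of \<open>q\<close>, and no \<open>p\<close> could be negative there.
\<close>

lemma reduced_cost_diff_le:
  assumes "norm (A q) \<le> a"
  shows "\<bar>reduced_cost c A \<pi>' q - reduced_cost c A \<pi> q\<bar> \<le> a * norm (\<pi>' - \<pi>)"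
proof -
  have "\<bar>reduced_cost c A \<pi>' q - reduced_cost c A \<pi> q\<bar> = \<bar>A q \<bullet> (\<pi>' - \<pi>)\<bar>"
    by (simp add: reduced_cost_def inner_diff_right abs_minus_commute)
  also have "\<dots> \<le> norm (A q) * norm (\<pi>' - \<pi>)"
    by (rule Cauchy_Schwarz_ineq2)
  also have "\<dots> \<le> a * norm (\<pi>' - \<pi>)"
    using assms by (rule mult_right_mono) simp
  finally show ?thesis .
qed

text \<open>The gap at \<open>\<pi>\<close> splits into the change of \<open>q\<close>, the gap at
  \<open>\<pi>'\<close> and the change of \<open>p\<close>. The middle term is nonpositive since
  \<open>q\<close> is a minimizer at \<open>\<pi>'\<close>; the two changes account for the factor
  2.\<close>

lemma pricing_solutions_gap:
  assumes q: "q \<in> pricing_solutions c A Q \<pi>'" and p: "p \<in> Q"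
    and bound: "\<And>q. q \<in> Q \<Longrightarrow> norm (A q) \<le> a"
  shows "reduced_cost c A \<pi> q - reduced_cost c A \<pi> p \<le> 2 * (a * norm (\<pi>' - \<pi>))"
proof -
  have "q \<in> Q" and "reduced_cost c A \<pi>' q \<le> reduced_cost c A \<pi>' p"
    using q p by (auto simp: pricing_solutions_def is_arg_min_linorder)
  then show ?thesis
    using reduced_cost_diff_le[of A q a c \<pi>' \<pi>] reduced_cost_diff_le[of A p a c \<pi>' \<pi>]
      bound[of q] bound[OF p]
    by linarith
qed

text \<open>A nonempty \<open>Q\<close> excludes the supremum of the empty set, which is minus
  infinity, so the later estimates can be done with a real bound.\<close>

lemma column_bound_real:
  assumes "Q \<noteq> {}" and "column_bound A Q < \<infinity>"
  obtains a where "column_bound A Q = ereal a" and "0 \<le> a"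
    and "\<And>q. q \<in> Q \<Longrightarrow> norm (A q) \<le> a"
proof -
  have upper: "ereal (norm (A q)) \<le> column_bound A Q" if "q \<in> Q" for q
    unfolding column_bound_def using that by (rule SUP_upper)
  obtain p where "p \<in> Q" using assms(1) by blast
  then have "0 \<le> column_bound A Q"
    using upper[of p] by (meson ereal_less_eq(5) norm_ge_zero order_trans)
  with assms(2) obtain a where "column_bound A Q = ereal a" "0 \<le> a"
    by (cases "column_bound A Q") auto
  with upper that show thesis by simp
qed

lemma pricing_solutions_negative:
  assumes neg: "Q_minus c A Q \<pi> \<noteq> {}" and fin: "column_bound A Q < \<infinity>"
    and dist: "ereal (norm (\<pi>' - \<pi>)) \<le> gamma_plus c A Q \<pi> / (2 * column_bound A Q)"
    and q: "q \<in> pricing_solutions c A Q \<pi>'"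
  shows "reduced_cost c A \<pi> q < 0"
proof (rule ccontr)
  assume "\<not> ?thesis"
  then have nonneg: "0 \<le> reduced_cost c A \<pi> q" by simp
  obtain p where p: "p \<in> Q" "reduced_cost c A \<pi> p < 0"
    using neg by (auto simp: Q_minus_def)
  then obtain a where a: "column_bound A Q = ereal a" "0 \<le> a"
    "\<And>q. q \<in> Q \<Longrightarrow> norm (A q) \<le> a"
    using column_bound_real[OF _ fin] by blast
  \<comment> \<open>Being nonnegative at \<open>\<pi>\<close>, \<open>q\<close> itself competes in
    the infimum defining \<open>gamma_plus\<close>, which is therefore not infinite here.\<close>
  have "q \<in> Q" using q by (simp add: pricing_solutions_def is_arg_min_def)
  with nonneg have gamma: "gamma_plus c A Q \<pi> \<le> ereal (reduced_cost c A \<pi> q)"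
    by (auto simp: gamma_plus_def Q_plus_def intro: INF_lower)
  have "2 * (a * norm (\<pi>' - \<pi>)) \<le> reduced_cost c A \<pi> q"
  \<comment> \<open>For \<open>a = 0\<close> the quotient in \<open>dist\<close> can be infinite and
    then bounds nothing, but the left-hand side vanishes.\<close>
  proof (cases "a = 0")
    case True
    with nonneg show ?thesis by simp
  next
    case False
    with a(2) have "0 < a" by simp
    have "ereal (norm (\<pi>' - \<pi>)) \<le> gamma_plus c A Q \<pi> / ereal (2 * a)"
      using dist a(1) by simp
    also have "\<dots> \<le> ereal (reduced_cost c A \<pi> q) / ereal (2 * a)"
      using gamma \<open>0 < a\<close> by (intro ereal_divide_right_mono) auto
    finally show ?thesis using \<open>0 < a\<close> by (simp add: field_simps)
  qed
  with pricing_solutions_gap[OF q p(1) a(3), of \<pi>] p(2) show False by simp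
qed

theorem proposition1:
  fixes b \<pi>_out \<pi>_sep :: "real ^ 'm"
    and c :: "'q \<Rightarrow> real"
    and A :: "'q \<Rightarrow> real ^ 'm"
    and Q R :: "'q set"
    and orc :: "real ^ 'm \<Rightarrow> 'q"
  assumes "R \<subseteq> Q"
    and "\<And>\<pi>. pricing_solutions c A Q \<pi> \<noteq> {}"
    and "exact_pricing_oracle c A Q orc"
    and "rmp_dual_optimal b c A R \<pi>_out"
    and "Q_minus c A Q \<pi>_out \<noteq> {}"
    and "column_bound A Q < \<infinity>"
    and "ereal (norm (\<pi>_sep - \<pi>_out))
           \<le> min (gamma_minus c A Q \<pi>_out) (gamma_plus c A Q \<pi>_out) / (2 * column_bound A Q)"
  shows "(\<forall>q \<in> pricing_solutions c A Q \<pi>_sep. reduced_cost c A \<pi>_out q < 0)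
         \<and> \<not> mispricing c A Q orc \<pi>_out \<pi>_sep"
proof -
  let ?g = "min (gamma_minus c A Q \<pi>_out) (gamma_plus c A Q \<pi>_out)"
  have "0 \<le> column_bound A Q"
  proof -
    have "Q \<noteq> {}" using assms(5) by (auto simp: Q_minus_def)
    then show ?thesis using column_bound_real[OF _ assms(6)] by (metis ereal_less_eq(5))
  qed
  \<comment> \<open>Written as multiplication by the inverse, the division is monotone even for a
    zero bound, because the \<open>ereal\<close> inverse of 0 is infinity and thus
    nonnegative.\<close>
  then have "?g / (2 * column_bound A Q) \<le> gamma_plus c A Q \<pi>_out / (2 * column_bound A Q)"
    unfolding divide_ereal_def
    by (intro ereal_mult_right_mono min.cobounded2) (simp add: ereal_inverse_nonneg_iff)
  with assms(7) have
    "ereal (norm (\<pi>_sep - \<pi>_out)) \<le> gamma_plus c A Q \<pi>_out / (2 * column_bound A Q)"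
    by (rule order_trans)
  then have negative: "\<forall>q \<in> pricing_solutions c A Q \<pi>_sep. reduced_cost c A \<pi>_out q < 0"
    using pricing_solutions_negative[OF assms(5,6)] by blast
  moreover have "orc \<pi>_sep \<in> pricing_solutions c A Q \<pi>_sep"
    using assms(3) by (simp add: exact_pricing_oracle_def)
  ultimately show ?thesis by (force simp: mispricing_def)
qed

end
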